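(* Assume the setting and conditions (K1)--(K4) of the context. Suppose that $u_n\in Y$ solves, for $0\le n\tau\le T$, the fully implicit midpoint rule $$\frac{u_{n+1}-u_n}{\tau}+A(\widehat u_{n+1/2})\frac{u_{n+1}+u_n}{2}=f(\widehat u_{n+1/2}),\qquad \widehat u_{n+1/2}=\frac{u_{n+1}+u_n}2,$$ and that $u_n^\star\in Y$ solves it up to a defect $d_{n+1/2}\in Y$, for $0\le n\tau\le T$: $$\frac{u^\star_{n+1}-u^\star_n}{\tau}+A(\widehat u^\star_{n+1/2})\frac{u^\star_{n+1}+u^\star_n}{2}=f(\widehat u^\star_{n+1/2})+d_{n+1/2},\qquad \widehat u^\star_{n+1/2}=\frac{u^\star_{n+1}+u^\star_n}2.$$ Suppose that, for $0\le n\tau\le T$, $$\|u_n^\star\|\le R\quad\text{and}\quad Su_n^\star\in Y\ \text{ with }\ \|Su_n^\star\|\le K.$$ Then there exist $\overline\tau>0$ and $\delta>0$, which depend only on $K$, $R$ and $T$, such that for stepsizes $\tau\le\overline\tau$ and perturbations satisfying $$\|u_0-u_0^\star\|^2+\tau\sum_{0\le n\tau\le T}\|d_{n+1/2}\|^2\le\delta^2,$$ the error satisfies, for $0\le n\tau\le T$, $$\|u_n-u_n^\star\|^2\le C_Y\Bigl(\|u_0-u_0^\star\|^2+\tau\sum_{k=0}^{n-1}\|d_{k+1/2}\|^2\Bigr),$$ $$|u_n-u_n^\star|^2\le C_X\Bigl(|u_0-u_0^\star|^2+\tau\sum_{k=0}^{n-1}|d_{k+1/2}|^2\Bigr),$$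 where $C_Y$ depends only on $K$, $R$ and $T$, and $C_X$ depends only on $R$ and $T$.
   Context: The quasi-linear evolution equation $\dot u+A(u)u=f(u)$ is discretized in time with stepsize $\tau>0$. Let $X$ and $Y$ be real Hilbert spaces such that $Y$ is densely and continuously embedded in $X$. The inner product on $X$ is $(\cdot,\cdot)$, and the norms are $|\cdot|=\|\cdot\|_X$ and $\|\cdot\|=\|\cdot\|_Y$, chosen such that $|y|\le\|y\|$ for all $y\in Y$. For every $R>0$ the following conditions hold, with real numbers $M_R^A,M_R^B,L_R^A,L_R^B,\ell_R^X,\ell_R^Y$ depending only on $R$. (K1) For every $y\in Y$, the closed linear operator $A(y)$ on $X$, with domain $D(A(y))$, has the open left complex half-plane in the resolvent set and satisfies $(w,A(y)w)\ge0$ for all $w\in D(A(y))$. Moreover, $D(A(y))$ contains $Y$, and for $y\in Y$ with $\|y\|\le R$, $|A(y)w|\le M_R^A\|w\|$ for all $w\in Y$. (K2) There exists an isometry $S:Y\to X$, self-adjoint as a linear operator on $X$, such that for every $y\in Y$ with $\|y\|\le R$, $SA(y)S^{-1}=A(y)+B(y)$ (with equality of domains), where $|B(y)v|\le M_R^B|v|$ for all $v\in X$. (K3) For all $y,\widetilde y\in Y$ with $\|y\|\le R$, $\|\widetilde y\|\le R$: $|(A(y)-A(\widetilde y))w|\le L_R^A|y-\widetilde y|\,\|w\|$ for all $w\in Y$, and $|(B(y)-B(\widetilde y))v|\le L_R^B\|y-\widetilde y\|\,|v|$ for all $v\in X$. (K4) The function $f:X\to X$ is $Y$-locally Lipschitz-continuous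 in $X$ and $Y$: for all $y,\widetilde y\in Y$ with $\|y\|\le R$, $\|\widetilde y\|\le R$, $|f(y)-f(\widetilde y)|\le\ell_R^X|y-\widetilde y|$ and $\|f(y)-f(\widetilde y)\|\le\ell_R^Y\|y-\widetilde y\|$.
   Formalization: The formal theorem adds that ‖u_{n+1}−u_n‖_Y ≤ ρ for (n+1)τ ≤ T, with ρ arbitrary, and the stepsize bound may also depend on ρ; without this the claim fails (X=Y=ℝ, A=0, f(v)=v³, u*=0, d=0, u_0=0, u_1=2√(2/τ)). *)

theory Defs
  imports "HOL-Analysis.Analysis"
begin

text \<open>
  A possibly unbounded operator on a real Hilbert space is a pair of a domain \<open>D\<close> and a total
  function \<open>T\<close>; the values of \<open>T\<close> outside \<open>D\<close> are irrelevant.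
\<close>

definition linear_operator_on :: "'x::real_vector set \<Rightarrow> ('x \<Rightarrow> 'x) \<Rightarrow> bool" where
  "linear_operator_on D T \<longleftrightarrow>
     subspace D \<and>
     (\<forall>v\<in>D. \<forall>w\<in>D. T (v + w) = T v + T w) \<and>
     (\<forall>c. \<forall>v\<in>D. T (c *\<^sub>R v) = c *\<^sub>R T v)"

definition closed_operator :: "'x::real_inner set \<Rightarrow> ('x \<Rightarrow> 'x) \<Rightarrow> bool" where
  "closed_operator D T \<longleftrightarrow> linear_operator_on D T \<and> closed ((\<lambda>v. (v, T v)) ` D)"

text \<open>The graph of the adjoint equals the graph of the (densely defined) operator.\<close>

definition self_adjoint_operator :: "'x::real_inner set \<Rightarrow> ('x \<Rightarrow> 'x) \<Rightarrow> bool" where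
  "self_adjoint_operator D T \<longleftrightarrow>
     linear_operator_on D T \<and> closure D = UNIV \<and>
     {(v, z). \<forall>w\<in>D. T w \<bullet> v = w \<bullet> z} = (\<lambda>v. (v, T v)) ` D"

text \<open>
  The complexification of \<open>'x\<close> is \<open>'x \<times> 'x\<close>, where \<open>(v, w)\<close> stands for \<open>v + \<i> w\<close>; the product norm
  is the Hilbert space norm of the complexification.
\<close>

definition cscale :: "complex \<Rightarrow> 'x::real_vector \<times> 'x \<Rightarrow> 'x \<times> 'x" where
  "cscale z p = (Re z *\<^sub>R fst p - Im z *\<^sub>R snd p, Re z *\<^sub>R snd p + Im z *\<^sub>R fst p)"

definition resolvent_set :: "'x::real_inner set \<Rightarrow> ('x \<Rightarrow> 'x) \<Rightarrow> complex set" where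
  "resolvent_set D T =
     {z. let F = (\<lambda>p. cscale z p - (T (fst p), T (snd p)))
         in bij_betw F (D \<times> D) UNIV \<and> bounded_linear (inv_into (D \<times> D) F)}"

text \<open>
  The space \<open>Y\<close> is the type \<open>'y\<close>, and its embedding into \<open>X\<close> is \<open>emb\<close>. The operator \<open>A(y)\<close> has
  domain \<open>dom y\<close>. As an operator on \<open>X\<close>, the map \<open>S\<close> has the domain \<open>range emb\<close>. The constants of
  the conditions are functions of the radius.
\<close>

locale kato_setting =
  fixes emb :: "'y::{real_inner, complete_space} \<Rightarrow> 'x::{real_inner, complete_space}"
    and dom :: "'y \<Rightarrow> 'x set"
    and A :: "'y \<Rightarrow> 'x \<Rightarrow> 'x"
    and S :: "'y \<Rightarrow> 'x"
    and B :: "'y \<Rightarrow> 'x \<Rightarrow> 'x"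
    and f :: "'x \<Rightarrow> 'x"
    and M\<^sub>A M\<^sub>B L\<^sub>A L\<^sub>B l\<^sub>X l\<^sub>Y :: "real \<Rightarrow> real"
  assumes emb_linear: "linear emb"
    and emb_inj: "inj emb"
    and emb_norm: "norm (emb y) \<le> norm y"
    and emb_dense: "closure (range emb) = UNIV"
    and K1_closed: "closed_operator (dom y) (A y)"
    and K1_resolvent: "{z. Re z < 0} \<subseteq> resolvent_set (dom y) (A y)"
    and K1_accretive: "v \<in> dom y \<Longrightarrow> 0 \<le> v \<bullet> A y v"
    and K1_dom: "range emb \<subseteq> dom y"
    and K1_bound: "0 < r \<Longrightarrow> norm y \<le> r \<Longrightarrow> norm (A y (emb w)) \<le> M\<^sub>A r * norm w"
    and K2_linear: "linear S"
    and K2_isometry: "norm (S y) = norm y"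
    and K2_self_adjoint: "self_adjoint_operator (range emb) (S \<circ> inv emb)"
    and K2_dom:
      "{v \<in> range S. emb (inv S v) \<in> dom y \<and> A y (emb (inv S v)) \<in> range emb} = dom y"
    and K2_similar: "v \<in> dom y \<Longrightarrow> S (inv emb (A y (emb (inv S v)))) = A y v + B y v"
    and K2_B_linear: "linear (B y)"
    and K2_B_bound: "0 < r \<Longrightarrow> norm y \<le> r \<Longrightarrow> norm (B y v) \<le> M\<^sub>B r * norm v"
    and K3_A: "0 < r \<Longrightarrow> norm y \<le> r \<Longrightarrow> norm y' \<le> r \<Longrightarrow>
      norm (A y (emb w) - A y' (emb w)) \<le> L\<^sub>A r * norm (emb y - emb y') * norm w"
    and K3_B: "0 < r \<Longrightarrow> norm y \<le> r \<Longrightarrow> norm y' \<le> r \<Longrightarrow>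
      norm (B y v - B y' v) \<le> L\<^sub>B r * norm (y - y') * norm v"
    and K4_range: "f (emb y) \<in> range emb"
    and K4_X: "0 < r \<Longrightarrow> norm y \<le> r \<Longrightarrow> norm y' \<le> r \<Longrightarrow>
      norm (f (emb y) - f (emb y')) \<le> l\<^sub>X r * norm (emb y - emb y')"
    and K4_Y: "0 < r \<Longrightarrow> norm y \<le> r \<Longrightarrow> norm y' \<le> r \<Longrightarrow>
      norm (inv emb (f (emb y)) - inv emb (f (emb y'))) \<le> l\<^sub>Y r * norm (y - y')"

text \<open>
  One step from \<open>y\<close> to \<open>y'\<close> of the fully implicit midpoint rule, with the defect \<open>d\<close>. The equation
  need not determine \<open>y'\<close>: for \<open>X = Y = \<real>\<close>, \<open>A = 0\<close>, \<open>f v = v ^ 3\<close> and \<open>d = 0\<close>, it takes \<open>0\<close> both to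
  \<open>0\<close> and to \<open>2 * sqrt (2 / \<tau>)\<close>, and every value has a successor. An error bound for arbitrary
  solutions of the equation is therefore false; the increments of the numerical solution have to
  be bounded independently of \<open>\<tau>\<close>.
\<close>

definition midpoint_step ::
  "('y::real_normed_vector \<Rightarrow> 'x::real_normed_vector) \<Rightarrow> ('y \<Rightarrow> 'x \<Rightarrow> 'x) \<Rightarrow> ('x \<Rightarrow> 'x) \<Rightarrow>
     real \<Rightarrow> 'y \<Rightarrow> 'y \<Rightarrow> 'y \<Rightarrow> bool" where
  "midpoint_step emb A f \<tau> d y y' \<longleftrightarrow>
     (emb y' - emb y) /\<^sub>R \<tau> + A (midpoint y y') ((emb y' + emb y) /\<^sub>R 2)
       = f (emb (midpoint y y')) + emb d"

end

theory Submission
  imports Defs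
begin

text \<open>
  The error \<open>e = u - us\<close> satisfies a midpoint rule whose operator \<open>A(w)\<close> is evaluated at the
  midpoint \<open>w\<close> of the numerical solution and whose right-hand side consists of \<open>f(w) - f(ws)\<close>, of
  \<open>- d\<close> and of \<open>- (A(w) - A(ws)) ws\<close>, where \<open>ws\<close> is the midpoint of the perturbed solution. The
  midpoint rule admits an exact energy identity: the increment of \<open>|e|\<^sup>2\<close> over a step is
  \<open>2 \<tau> (h, E)\<close>, where \<open>h\<close> is the difference quotient and \<open>E\<close> the midpoint of the error. In \<open>X\<close>,
  accretivity removes the term \<open>A(w) E\<close>, and the other terms are bounded by \<open>|E|\<^sup>2\<close> and \<open>|d| |E|\<close>.

  In \<open>Y\<close> the same identity is used after applying the isometry \<open>S\<close>. Now \<open>A(w) E\<close> has to lie in \<open>Y\<close>: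
  \<open>A(w) w\<close> does by the equation, and \<open>A(w) ws\<close> does because \<open>S ws \<in> Y \<subseteq> D(A(w))\<close> and the domains of
  \<open>S A(w) S\<^sup>-\<^sup>1\<close> and \<open>A(w)\<close> coincide. Then \<open>S A(w) E = (A(w) + B(w)) S E\<close>, and accretivity can be used
  once more. The same commutation turns \<open>S (A(w) - A(ws)) ws\<close> into differences of \<open>A\<close> and \<open>B\<close> applied
  to \<open>S ws\<close>, and here the bound \<open>K\<close> of \<open>S us\<close> in \<open>Y\<close> is needed. In both spaces a discrete Gronwall
  inequality follows.

  The constants depend on a bound \<open>r\<close> of the midpoints in \<open>Y\<close>, for which \<open>R + 1\<close> must be justified.
  This is done by induction over the steps: if it holds up to the \<open>n\<close>-th step, the \<open>n\<close>-th error is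
  small for small \<open>\<delta>\<close>. The bound \<open>\<rho>\<close> on the increments then gives a crude bound of the next midpoint,
  and the one-step estimate with the constants belonging to that crude radius shows, for \<open>\<tau>\<close> small in
  terms of \<open>\<rho>\<close>, that the next error is at most \<open>1\<close>. So \<open>R + 1\<close> holds for the next step as well, and
  \<open>\<rho>\<close> affects only the step size restriction, not the constants of the error bounds.
\<close>

section \<open>Energy estimates for difference equations\<close>

lemma midpoint_diff:
  fixes a b c d :: "'z::real_vector"
  shows "midpoint a b - midpoint c d = midpoint (a - c) (b - d)"
  by (simp add: midpoint_def algebra_simps)

lemma norm_midpoint_le:
  fixes a b :: "'z::real_normed_vector"
  assumes "norm a \<le> r" "norm b \<le> r"
  shows "norm (midpoint a b) \<le> r"
  using assms norm_triangle_ineq[of a b] by (simp add: midpoint_def)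

lemma linear_midpoint:
  assumes "linear g"
  shows "g (midpoint a b) = midpoint (g a) (g b)"
  by (simp add: midpoint_def linear_add[OF assms] linear_scale[OF assms])

text \<open>
  Testing \<open>e' - e = \<tau> h\<close> with the midpoint \<open>E\<close> gives \<open>|e'|\<^sup>2 - |e|\<^sup>2 = 2 \<tau> (h, E)\<close>. The part of the
  resulting bound that contains \<open>e'\<close> is absorbed into the left-hand side, for which \<open>\<tau>\<close> must be small.
\<close>

lemma midpoint_energy_step:
  fixes e e' :: "'z::real_inner"
  assumes "0 < \<tau>" and small: "(2 * k + 1) * \<tau> \<le> 1" and "0 \<le> k"
    and quot: "((e' - e) /\<^sub>R \<tau>) \<bullet> midpoint e e' \<le> k * (norm (midpoint e e'))\<^sup>2 + g * norm (midpoint e e')"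
  shows "(norm e')\<^sup>2 \<le> (1 + 2 * (2 * k + 1) * \<tau>) * (norm e)\<^sup>2 + 2 * \<tau> * g\<^sup>2"
proof -
  define E where "E = norm (midpoint e e')"
  define c where "c = 2 * k + 1"
  define x where "x = c * \<tau> / 2"
  have x: "0 \<le> x" "x \<le> 1 / 2"
    using assms by (auto simp: x_def c_def)
  have "(norm e')\<^sup>2 - (norm e)\<^sup>2 = 2 * ((e' - e) \<bullet> midpoint e e')"
    by (simp add: midpoint_def power2_norm_eq_inner inner_simps inner_commute)
  also have "\<dots> = 2 * \<tau> * (((e' - e) /\<^sub>R \<tau>) \<bullet> midpoint e e')"
    using \<open>0 < \<tau>\<close> by simp
  also have "\<dots> \<le> 2 * \<tau> * (k * E\<^sup>2 + g * E)"
    using quot \<open>0 < \<tau>\<close> unfolding E_def by (intro mult_left_mono) auto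
  also have "\<dots> \<le> \<tau> * (c * E\<^sup>2 + g\<^sup>2)"
  proof -
    have "2 * (g * E) \<le> g\<^sup>2 + E\<^sup>2"
      using sum_squares_bound[of g E] by simp
    then have "\<tau> * (2 * (k * E\<^sup>2 + g * E)) \<le> \<tau> * (c * E\<^sup>2 + g\<^sup>2)"
      using \<open>0 < \<tau>\<close> by (intro mult_left_mono) (auto simp: c_def algebra_simps)
    then show ?thesis
      by (simp add: mult.assoc mult.left_commute)
  qed
  also have "\<dots> \<le> x * ((norm e)\<^sup>2 + (norm e')\<^sup>2) + \<tau> * g\<^sup>2"
  proof -
    have "E \<le> (norm e + norm e') / 2"
      using norm_triangle_ineq[of e e'] by (simp add: E_def midpoint_def)
    then have "E\<^sup>2 \<le> ((norm e + norm e') / 2)\<^sup>2"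
      by (simp add: E_def power_mono)
    also have "\<dots> \<le> ((norm e)\<^sup>2 + (norm e')\<^sup>2) / 2"
      using sum_squares_bound[of "norm e" "norm e'"] by (simp add: power2_eq_square field_simps)
    finally have "(c * \<tau>) * E\<^sup>2 \<le> (c * \<tau>) * (((norm e)\<^sup>2 + (norm e')\<^sup>2) / 2)"
      using x by (intro mult_left_mono) (auto simp: x_def)
    then show ?thesis
      by (simp add: x_def algebra_simps)
  qed
  finally have main: "(1 - x) * (norm e')\<^sup>2 \<le> (1 + x) * (norm e)\<^sup>2 + \<tau> * g\<^sup>2"
    by (simp add: algebra_simps)
  also have "\<dots> \<le> ((1 - x) * (1 + 4 * x)) * (norm e)\<^sup>2 + (1 - x) * (2 * \<tau> * g\<^sup>2)"
  proof (intro add_mono mult_right_mono)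
    have "0 \<le> 2 * x * (1 - 2 * x)"
      using x by (intro mult_nonneg_nonneg) auto
    then show "1 + x \<le> (1 - x) * (1 + 4 * x)"
      by (simp add: algebra_simps power2_eq_square)
    have "1 * (\<tau> * g\<^sup>2) \<le> (2 * (1 - x)) * (\<tau> * g\<^sup>2)"
      using x \<open>0 < \<tau>\<close> by (intro mult_right_mono) auto
    then show "\<tau> * g\<^sup>2 \<le> (1 - x) * (2 * \<tau> * g\<^sup>2)"
      by (simp add: algebra_simps)
  qed auto
  finally have "(1 - x) * (norm e')\<^sup>2 \<le> (1 - x) * ((1 + 4 * x) * (norm e)\<^sup>2 + 2 * \<tau> * g\<^sup>2)"
    by (simp add: algebra_simps)
  then have "(norm e')\<^sup>2 \<le> (1 + 4 * x) * (norm e)\<^sup>2 + 2 * \<tau> * g\<^sup>2"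
    using x by (simp add: mult_le_cancel_left)
  moreover have "4 * x = 2 * (2 * k + 1) * \<tau>"
    by (simp add: x_def c_def)
  ultimately show ?thesis
    by (simp only:)
qed

lemma discrete_gronwall:
  fixes a b :: "nat \<Rightarrow> real"
  assumes "0 \<le> q" and "\<And>k. 0 \<le> b k"
    and "\<And>k. k < n \<Longrightarrow> a (Suc k) \<le> (1 + q) * a k + b k"
  shows "a n \<le> (1 + q) ^ n * (a 0 + (\<Sum>k<n. b k))"
  using assms(3)
proof (induction n)
  case 0
  then show ?case by simp
next
  case (Suc n)
  have "a (Suc n) \<le> (1 + q) * ((1 + q) ^ n * (a 0 + (\<Sum>k<n. b k))) + b n"
    using Suc.prems[OF lessI] mult_left_mono[OF Suc.IH[OF Suc.prems[OF less_SucI]], of "1 + q"]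
      \<open>0 \<le> q\<close> by linarith
  also have "b n \<le> (1 + q) ^ Suc n * b n"
    using mult_right_mono[OF one_le_power[of "1 + q" "Suc n"] assms(2)[of n]] \<open>0 \<le> q\<close> by simp
  finally show ?case
    by (simp add: algebra_simps)
qed

lemma discrete_gronwall_exp:
  fixes a g :: "nat \<Rightarrow> real"
  assumes "0 < \<tau>" "0 \<le> c" "real n * \<tau> \<le> T" and nonneg: "0 \<le> a 0" "\<And>k. 0 \<le> g k"
    and step: "\<And>k. k < n \<Longrightarrow> a (Suc k) \<le> (1 + c * \<tau>) * a k + 2 * \<tau> * g k"
  shows "a n \<le> 2 * exp (c * T) * (a 0 + \<tau> * (\<Sum>k<n. g k))"
proof -
  have "a n \<le> (1 + c * \<tau>) ^ n * (a 0 + (\<Sum>k<n. 2 * \<tau> * g k))"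
    using assms by (intro discrete_gronwall) auto
  also have "\<dots> \<le> exp (c * T) * (2 * (a 0 + \<tau> * (\<Sum>k<n. g k)))"
  proof (intro mult_mono)
    have "(1 + c * \<tau>) ^ n \<le> exp (c * \<tau>) ^ n"
      using assms by (intro power_mono exp_ge_add_one_self) auto
    also have "\<dots> = exp (c * (real n * \<tau>))"
      by (simp add: exp_of_nat_mult[symmetric] algebra_simps)
    also have "\<dots> \<le> exp (c * T)"
      using assms by (simp add: mult_left_mono)
    finally show "(1 + c * \<tau>) ^ n \<le> exp (c * T)" .
    show "a 0 + (\<Sum>k<n. 2 * \<tau> * g k) \<le> 2 * (a 0 + \<tau> * (\<Sum>k<n. g k))"
      using nonneg by (simp add: sum_distrib_left[symmetric] mult.assoc)
    show "0 \<le> a 0 + (\<Sum>k<n. 2 * \<tau> * g k)"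
      using nonneg \<open>0 < \<tau>\<close> by (intro add_nonneg_nonneg sum_nonneg) auto
  qed auto
  finally show ?thesis
    by (simp add: algebra_simps)
qed

section \<open>The error of one midpoint step\<close>

context kato_setting
begin

lemma emb_inv: "v \<in> range emb \<Longrightarrow> emb (inv emb v) = v"
  by (rule f_inv_into_f)

lemma emb_in_dom: "emb w \<in> dom y"
  using K1_dom by auto

lemma A_diff:
  assumes "v \<in> dom y" "w \<in> dom y"
  shows "A y (v - w) = A y v - A y w"
proof -
  have lin: "linear_operator_on (dom y) (A y)"
    using K1_closed by (simp add: closed_operator_def)
  then have "- 1 *\<^sub>R w \<in> dom y"
    using assms subspace_scale unfolding linear_operator_on_def by blast
  then have "A y (v + (- 1) *\<^sub>R w) = A y v + (- 1) *\<^sub>R A y w"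
    using lin assms unfolding linear_operator_on_def by metis
  then show ?thesis by simp
qed

lemma inj_S: "inj S"
proof (rule injI)
  fix a b assume "S a = S b"
  then have "norm (a - b) = 0"
    using K2_isometry[of "a - b"] by (simp add: linear_diff[OF K2_linear])
  then show "a = b" by simp
qed

lemma S_inner: "S a \<bullet> S b = a \<bullet> b"
  using K2_isometry[of "a + b"] K2_isometry[of a] K2_isometry[of b]
  by (simp add: linear_add[OF K2_linear] dot_norm)

text \<open>
  The domain of \<open>S A(y) S\<^sup>-\<^sup>1\<close> is that of \<open>A(y)\<close> and so contains \<open>Y\<close>. This makes \<open>A(y)\<close> map every \<open>w\<close>
  with \<open>S w \<in> Y\<close> into \<open>Y\<close>.
\<close>

lemma A_range_emb_if_S_range_emb:
  assumes "S w \<in> range emb"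
  shows "A y (emb w) \<in> range emb"
proof -
  have "S w \<in> dom y"
    using assms K1_dom by blast
  then have "A y (emb (inv S (S w))) \<in> range emb"
    using K2_dom[of y] by auto
  then show ?thesis
    by (simp add: inv_f_f[OF inj_S])
qed

lemma S_commutation:
  assumes "emb g = A y (emb w)"
  shows "S w \<in> dom y" and "S g = A y (S w) + B y (S w)"
proof -
  have inv_S: "inv S (S w) = w"
    by (rule inv_f_f[OF inj_S])
  have "A y (emb w) \<in> range emb"
    by (metis assms rangeI)
  then show dom: "S w \<in> dom y"
    using K2_dom[of y] inv_S emb_in_dom by auto
  show "S g = A y (S w) + B y (S w)"
    using K2_similar[OF dom] by (simp add: inv_S assms[symmetric] inv_f_f[OF emb_inj])
qed

text \<open>
  The vector that \<open>A\<close> acts on is the embedding of the very point of \<open>Y\<close> at which \<open>A\<close> is evaluated, so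
  that the step is an equation for a single midpoint and a difference quotient, both in \<open>Y\<close>.
\<close>

lemma midpoint_step_iff:
  "midpoint_step emb A f \<tau> d u u' \<longleftrightarrow>
     emb ((u' - u) /\<^sub>R \<tau>) + A (midpoint u u') (emb (midpoint u u')) = f (emb (midpoint u u')) + emb d"
proof -
  have "(emb u' + emb u) /\<^sub>R 2 = emb (midpoint u u')"
    by (simp add: midpoint_def linear_add[OF emb_linear] linear_scale[OF emb_linear] add.commute)
  then show ?thesis
    by (simp add: midpoint_step_def linear_diff[OF emb_linear] linear_scale[OF emb_linear])
qed

text \<open>
  The growth rates of the error in \<open>X\<close> and in \<open>Y\<close> when \<open>r\<close> bounds both midpoints. The absolute values
  make the rates nonnegative also when \<open>Y\<close> is trivial, so that the constants of the conditions can be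
  negative, and for arbitrary real \<open>K\<close>.
\<close>

definition rate_X :: "real \<Rightarrow> real" where
  "rate_X r = \<bar>l\<^sub>X r\<bar> + \<bar>L\<^sub>A r\<bar> * r"

definition rate_Y :: "real \<Rightarrow> real \<Rightarrow> real" where
  "rate_Y r K = \<bar>l\<^sub>Y r\<bar> + \<bar>M\<^sub>B r\<bar> + \<bar>L\<^sub>A r\<bar> * \<bar>K\<bar> + \<bar>L\<^sub>B r\<bar> * r"

lemma rates_nonneg: "0 < r \<Longrightarrow> 0 \<le> rate_X r" "0 < r \<Longrightarrow> 0 \<le> rate_Y r K"
  by (simp_all add: rate_X_def rate_Y_def)

text \<open>
  In the next two lemmas \<open>w\<close> and \<open>ws\<close> are the midpoints and \<open>h\<close> is the difference quotient of the
  error, so that \<open>residual\<close> is the difference of the two midpoint equations. Both split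
  \<open>A(w) w - A(ws) ws\<close> as \<open>A(w) (w - ws) + (A(w) - A(ws)) ws\<close>.
\<close>

lemma error_quotient_X:
  assumes r: "0 < r" "norm w \<le> r" "norm ws \<le> r"
    and residual: "emb h = f (emb w) - f (emb ws) - emb d - A w (emb w) + A ws (emb ws)"
  shows "emb h \<bullet> emb (w - ws)
    \<le> rate_X r * (norm (emb (w - ws)))\<^sup>2 + norm (emb d) * norm (emb (w - ws))"
proof -
  let ?E = "emb (w - ws)"
  have E: "?E = emb w - emb ws"
    by (rule linear_diff[OF emb_linear])
  have split: "emb h = (f (emb w) - f (emb ws)) - emb d - A w ?E - (A w (emb ws) - A ws (emb ws))"
    unfolding residual E A_diff[OF emb_in_dom emb_in_dom] by simp
  have 1: "(f (emb w) - f (emb ws)) \<bullet> ?E \<le> \<bar>l\<^sub>X r\<bar> * norm ?E * norm ?E"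
    unfolding E
    by (intro order_trans[OF norm_cauchy_schwarz] mult_right_mono order_trans[OF K4_X[OF r]]) auto
  have 2: "- (emb d \<bullet> ?E) \<le> norm (emb d) * norm ?E"
    using norm_cauchy_schwarz[of "- emb d" ?E] by simp
  have 3: "0 \<le> A w ?E \<bullet> ?E"
    using K1_accretive[OF emb_in_dom] by (simp add: inner_commute)
  have "norm (A w (emb ws) - A ws (emb ws)) \<le> (\<bar>L\<^sub>A r\<bar> * norm ?E) * r"
    unfolding E using r
    by (intro order_trans[OF K3_A[OF r]] mult_mono) auto
  then have 4: "- ((A w (emb ws) - A ws (emb ws)) \<bullet> ?E) \<le> \<bar>L\<^sub>A r\<bar> * norm ?E * r * norm ?E"
    using order_trans[OF norm_cauchy_schwarz[of "- (A w (emb ws) - A ws (emb ws))" ?E] mult_right_mono]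
    by (simp add: inner_simps norm_minus_commute)
  have "emb h \<bullet> ?E = (f (emb w) - f (emb ws)) \<bullet> ?E - emb d \<bullet> ?E - A w ?E \<bullet> ?E
      - (A w (emb ws) - A ws (emb ws)) \<bullet> ?E"
    unfolding split by (simp add: inner_diff_left)
  also have "\<dots> \<le> \<bar>l\<^sub>X r\<bar> * norm ?E * norm ?E + norm (emb d) * norm ?E
      + \<bar>L\<^sub>A r\<bar> * norm ?E * r * norm ?E"
    using 1 2 3 4 by linarith
  finally show ?thesis
    by (simp add: rate_X_def power2_eq_square algebra_simps)
qed

lemma error_quotient_Y:
  assumes r: "0 < r" "norm w \<le> r" "norm ws \<le> r"
    and residual: "emb h = f (emb w) - f (emb ws) - emb d - A w (emb w) + A ws (emb ws)"
    and A_w: "A w (emb w) \<in> range emb"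
    and S_ws: "emb z = S ws" "norm z \<le> K"
  shows "h \<bullet> (w - ws) \<le> rate_Y r K * (norm (w - ws))\<^sup>2 + norm d * norm (w - ws)"
proof -
  define E where "E = w - ws"
  define F where "F = inv emb (f (emb w)) - inv emb (f (emb ws))"
  have emb_E: "emb E = emb w - emb ws"
    unfolding E_def by (rule linear_diff[OF emb_linear])
  have emb_F: "emb F = f (emb w) - f (emb ws)"
    by (simp add: F_def linear_diff[OF emb_linear] emb_inv[OF K4_range])
  obtain g1 where g1: "emb g1 = A w (emb w)"
    using A_w by (metis imageE)
  obtain g2 where g2: "emb g2 = A w (emb ws)"
    using A_range_emb_if_S_range_emb[of ws w] S_ws(1) by (metis imageE rangeI)
  obtain g3 where g3: "emb g3 = A ws (emb ws)"
    using A_range_emb_if_S_range_emb[of ws ws] S_ws(1) by (metis imageE rangeI)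
  have "emb h = emb (F - d - (g1 - g2) - (g2 - g3))"
    by (simp add: linear_diff[OF emb_linear] linear_add[OF emb_linear] emb_F g1 g3 residual)
  then have h: "h = F - d - (g1 - g2) - (g2 - g3)"
    using emb_inj by (auto dest: injD)
  have "emb (g1 - g2) = A w (emb E)"
    by (simp add: linear_diff[OF emb_linear] g1 g2 emb_E A_diff[OF emb_in_dom emb_in_dom])
  note S_E = S_commutation[OF this]
  have 1: "F \<bullet> E \<le> \<bar>l\<^sub>Y r\<bar> * norm E * norm E"
    unfolding E_def F_def
    by (intro order_trans[OF norm_cauchy_schwarz] mult_right_mono order_trans[OF K4_Y[OF r]]) auto
  have 2: "- (d \<bullet> E) \<le> norm d * norm E"
    using norm_cauchy_schwarz[of "- d" E] by simp
  have "norm (B w (S E)) \<le> \<bar>M\<^sub>B r\<bar> * norm E"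
    by (intro order_trans[OF K2_B_bound[OF r(1,2)]]) (simp add: K2_isometry mult_right_mono)
  then have "- (B w (S E) \<bullet> S E) \<le> \<bar>M\<^sub>B r\<bar> * norm E * norm E"
    using order_trans[OF norm_cauchy_schwarz[of "- B w (S E)" "S E"] mult_right_mono]
    by (simp add: K2_isometry)
  moreover have "0 \<le> A w (S E) \<bullet> S E"
    using K1_accretive[OF S_E(1)] by (simp add: inner_commute)
  moreover have "(g1 - g2) \<bullet> E = A w (S E) \<bullet> S E + B w (S E) \<bullet> S E"
    using S_inner[of "g1 - g2" E] by (simp add: S_E(2) inner_add_left)
  ultimately have 3: "- ((g1 - g2) \<bullet> E) \<le> \<bar>M\<^sub>B r\<bar> * norm E * norm E"
    by linarith
  have "norm (g2 - g3) = norm (S g2 - S g3)"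
    using K2_isometry[of "g2 - g3"] by (simp add: linear_diff[OF K2_linear])
  also have "S g2 - S g3 = (A w (emb z) - A ws (emb z)) + (B w (S ws) - B ws (S ws))"
    by (simp add: S_commutation(2)[OF g2] S_commutation(2)[OF g3] S_ws(1))
  also have "norm \<dots> \<le> \<bar>L\<^sub>A r\<bar> * norm E * \<bar>K\<bar> + \<bar>L\<^sub>B r\<bar> * norm E * r"
  proof (intro order_trans[OF norm_triangle_ineq] add_mono)
    have "norm (emb w - emb ws) \<le> norm E"
      using emb_norm[of E] by (simp add: emb_E)
    then show "norm (A w (emb z) - A ws (emb z)) \<le> \<bar>L\<^sub>A r\<bar> * norm E * \<bar>K\<bar>"
      using S_ws(2) by (intro order_trans[OF K3_A[OF r]] mult_mono) auto
    show "norm (B w (S ws) - B ws (S ws)) \<le> \<bar>L\<^sub>B r\<bar> * norm E * r"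
      using r unfolding E_def
      by (intro order_trans[OF K3_B[OF r]] mult_mono) (auto simp: K2_isometry)
  qed
  finally have 4: "- ((g2 - g3) \<bullet> E) \<le> (\<bar>L\<^sub>A r\<bar> * norm E * \<bar>K\<bar> + \<bar>L\<^sub>B r\<bar> * norm E * r) * norm E"
    using order_trans[OF norm_cauchy_schwarz[of "- (g2 - g3)" E] mult_right_mono]
    by (simp add: inner_simps norm_minus_commute)
  have "h \<bullet> E = F \<bullet> E - d \<bullet> E - (g1 - g2) \<bullet> E - (g2 - g3) \<bullet> E"
    unfolding h by (simp only: inner_diff_left)
  also have "\<dots> \<le> \<bar>l\<^sub>Y r\<bar> * norm E * norm E + norm d * norm E + \<bar>M\<^sub>B r\<bar> * norm E * norm E
      + (\<bar>L\<^sub>A r\<bar> * norm E * \<bar>K\<bar> + \<bar>L\<^sub>B r\<bar> * norm E * r) * norm E"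
    using 1 2 3 4 by linarith
  finally show ?thesis
    by (simp add: rate_Y_def E_def power2_eq_square algebra_simps)
qed

lemma midpoint_step_error:
  assumes step: "midpoint_step emb A f \<tau> 0 u u'" "midpoint_step emb A f \<tau> d us us'"
    and "0 < \<tau>" and r: "0 < r" "norm (midpoint u u') \<le> r" "norm us \<le> r" "norm us' \<le> r"
  shows "(2 * rate_X r + 1) * \<tau> \<le> 1 \<Longrightarrow>
      (norm (emb u' - emb us'))\<^sup>2
        \<le> (1 + 2 * (2 * rate_X r + 1) * \<tau>) * (norm (emb u - emb us))\<^sup>2 + 2 * \<tau> * (norm (emb d))\<^sup>2"
    and "\<lbrakk>(2 * rate_Y r K + 1) * \<tau> \<le> 1; emb z = S us; norm z \<le> K; emb z' = S us'; norm z' \<le> K\<rbrakk> \<Longrightarrow>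
      (norm (u' - us'))\<^sup>2
        \<le> (1 + 2 * (2 * rate_Y r K + 1) * \<tau>) * (norm (u - us))\<^sup>2 + 2 * \<tau> * (norm d)\<^sup>2"
proof -
  define w where "w = midpoint u u'"
  define ws where "ws = midpoint us us'"
  define h where "h = ((u' - us') - (u - us)) /\<^sub>R \<tau>"
  have ws: "norm ws \<le> r"
    unfolding ws_def by (rule norm_midpoint_le[OF r(3,4)])
  have E: "w - ws = midpoint (u - us) (u' - us')"
    by (simp add: w_def ws_def midpoint_diff)
  have emb_0: "emb 0 = 0"
    by (rule linear_0[OF emb_linear])
  have eq: "emb ((u' - u) /\<^sub>R \<tau>) + A w (emb w) = f (emb w)"
      "emb ((us' - us) /\<^sub>R \<tau>) + A ws (emb ws) = f (emb ws) + emb d"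
    using step by (simp_all add: midpoint_step_iff w_def ws_def emb_0)
  have "h = (u' - u) /\<^sub>R \<tau> - (us' - us) /\<^sub>R \<tau>"
    by (simp add: h_def algebra_simps)
  then have "emb h = emb ((u' - u) /\<^sub>R \<tau>) - emb ((us' - us) /\<^sub>R \<tau>)"
    by (simp only: linear_diff[OF emb_linear])
  also have "\<dots> = f (emb w) - f (emb ws) - emb d - A w (emb w) + A ws (emb ws)"
    using eq by (simp add: algebra_simps)
  finally have residual: "emb h = \<dots>" .
  show "(norm (emb u' - emb us'))\<^sup>2
      \<le> (1 + 2 * (2 * rate_X r + 1) * \<tau>) * (norm (emb u - emb us))\<^sup>2 + 2 * \<tau> * (norm (emb d))\<^sup>2"
    if "(2 * rate_X r + 1) * \<tau> \<le> 1"
  proof (rule midpoint_energy_step[OF \<open>0 < \<tau>\<close> that rates_nonneg(1)[OF r(1)]])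
    have "emb h = (emb u' - emb us' - (emb u - emb us)) /\<^sub>R \<tau>"
      by (simp add: h_def linear_diff[OF emb_linear] linear_scale[OF emb_linear])
    moreover have "emb (w - ws) = midpoint (emb u - emb us) (emb u' - emb us')"
      by (simp add: E linear_midpoint[OF emb_linear] linear_diff[OF emb_linear])
    ultimately show "((emb u' - emb us' - (emb u - emb us)) /\<^sub>R \<tau>)
        \<bullet> midpoint (emb u - emb us) (emb u' - emb us')
      \<le> rate_X r * (norm (midpoint (emb u - emb us) (emb u' - emb us')))\<^sup>2
        + norm (emb d) * norm (midpoint (emb u - emb us) (emb u' - emb us'))"
      using error_quotient_X[OF r(1,2)[folded w_def] ws residual] by simp
  qed
  show "(norm (u' - us'))\<^sup>2
      \<le> (1 + 2 * (2 * rate_Y r K + 1) * \<tau>) * (norm (u - us))\<^sup>2 + 2 * \<tau> * (norm d)\<^sup>2"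
    if small: "(2 * rate_Y r K + 1) * \<tau> \<le> 1"
      and z: "emb z = S us" "norm z \<le> K" "emb z' = S us'" "norm z' \<le> K"
  proof (rule midpoint_energy_step[OF \<open>0 < \<tau>\<close> small rates_nonneg(2)[OF r(1)]])
    \<comment> \<open>The equation exhibits \<open>A(w) w\<close> as a difference of elements of \<open>Y\<close>.\<close>
    have "A w (emb w) = emb (inv emb (f (emb w)) - (u' - u) /\<^sub>R \<tau>)"
      using eq(1) unfolding linear_diff[OF emb_linear] emb_inv[OF K4_range] by (simp add: algebra_simps)
    then have A_w: "A w (emb w) \<in> range emb"
      by simp
    have S_ws: "emb (midpoint z z') = S ws"
      by (simp add: ws_def linear_midpoint[OF emb_linear] linear_midpoint[OF K2_linear] z)
    show "((u' - us' - (u - us)) /\<^sub>R \<tau>) \<bullet> midpoint (u - us) (u' - us')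
      \<le> rate_Y r K * (norm (midpoint (u - us) (u' - us')))\<^sup>2 + norm d * norm (midpoint (u - us) (u' - us'))"
      using error_quotient_Y[OF r(1,2)[folded w_def] ws residual A_w S_ws norm_midpoint_le[OF z(2,4)]]
      by (simp add: E h_def)
  qed
qed

end

section \<open>Stability over the time interval\<close>

theorem lemma3p4:
  fixes emb :: "'y::{real_inner, complete_space} \<Rightarrow> 'x::{real_inner, complete_space}"
    and dom :: "'y \<Rightarrow> 'x set"
    and A :: "'y \<Rightarrow> 'x \<Rightarrow> 'x"
    and S :: "'y \<Rightarrow> 'x"
    and B :: "'y \<Rightarrow> 'x \<Rightarrow> 'x"
    and f :: "'x \<Rightarrow> 'x"
    and M\<^sub>A M\<^sub>B L\<^sub>A L\<^sub>B l\<^sub>X l\<^sub>Y :: "real \<Rightarrow> real"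
    and R T :: real
  assumes "kato_setting emb dom A S B f M\<^sub>A M\<^sub>B L\<^sub>A L\<^sub>B l\<^sub>X l\<^sub>Y"
    and "0 < R"
  shows "\<exists>C\<^sub>X::real. \<forall>K::real. \<exists>C\<^sub>Y::real. \<exists>\<delta>>0. \<forall>\<rho>::real. \<exists>\<tau>\<^sub>0>0.
    \<forall>(\<tau>::real) (u :: nat \<Rightarrow> 'y) (us :: nat \<Rightarrow> 'y) (d :: nat \<Rightarrow> 'y).
      0 < \<tau> \<longrightarrow> \<tau> \<le> \<tau>\<^sub>0 \<longrightarrow>
      (\<forall>n. real n * \<tau> \<le> T \<longrightarrow> midpoint_step emb A f \<tau> 0 (u n) (u (Suc n))) \<longrightarrow>
      (\<forall>n. real (Suc n) * \<tau> \<le> T \<longrightarrow> norm (u (Suc n) - u n) \<le> \<rho>) \<longrightarrow>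
      (\<forall>n. real n * \<tau> \<le> T \<longrightarrow> midpoint_step emb A f \<tau> (d n) (us n) (us (Suc n))) \<longrightarrow>
      (\<forall>n. real n * \<tau> \<le> T \<longrightarrow> norm (us n) \<le> R) \<longrightarrow>
      (\<forall>n. real n * \<tau> \<le> T \<longrightarrow> (\<exists>z. emb z = S (us n) \<and> norm z \<le> K)) \<longrightarrow>
      (norm (u 0 - us 0))\<^sup>2 + \<tau> * (\<Sum>n | real n * \<tau> \<le> T. (norm (d n))\<^sup>2) \<le> \<delta>\<^sup>2 \<longrightarrow>
      (\<forall>n. real n * \<tau> \<le> T \<longrightarrow>
         (norm (u n - us n))\<^sup>2
           \<le> C\<^sub>Y * ((norm (u 0 - us 0))\<^sup>2 + \<tau> * (\<Sum>k<n. (norm (d k))\<^sup>2)) \<and>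
         (norm (emb (u n) - emb (us n)))\<^sup>2
           \<le> C\<^sub>X * ((norm (emb (u 0) - emb (us 0)))\<^sup>2 + \<tau> * (\<Sum>k<n. (norm (emb (d k)))\<^sup>2)))"
proof -
  interpret kato_setting emb dom A S B f M\<^sub>A M\<^sub>B L\<^sub>A L\<^sub>B l\<^sub>X l\<^sub>Y
    by fact
  define c\<^sub>X where "c\<^sub>X = 2 * rate_X (R + 1) + 1"
  define c\<^sub>Y where "c\<^sub>Y K = 2 * rate_Y (R + 1) K + 1" for K
  define C\<^sub>X where "C\<^sub>X = 2 * exp (2 * c\<^sub>X * T)"
  define C\<^sub>Y where "C\<^sub>Y K = 2 * exp (2 * c\<^sub>Y K * T)" for K
  \<comment> \<open>The radius that bounds a midpoint when \<open>\<rho>\<close> bounds the increments and its left end has an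
    error of at most \<open>1\<close>.\<close>
  define crude where "crude \<rho> = R + 1 + \<bar>\<rho>\<bar>" for \<rho> :: real
  define c' where "c' K \<rho> = 2 * rate_Y (crude \<rho>) K + 1" for K \<rho>
  \<comment> \<open>With the second entry, an admissible perturbation keeps the squared error in \<open>Y\<close> below \<open>1 / 8\<close> as
    long as \<open>R + 1\<close> bounds the midpoints; with the first, \<open>\<tau> \<parallel>d\<parallel>\<^sup>2\<close> is at most \<open>1 / 8\<close> in each single step.
    In the crude step these give \<open>3 / 8 + 2 / 8 \<le> 1\<close>.\<close>
  define \<delta> where "\<delta> K = sqrt (min (1 / 8) (1 / (8 * C\<^sub>Y K)))" for K
  define \<tau>\<^sub>0 where "\<tau>\<^sub>0 K \<rho> = min (1 / c\<^sub>X) (min (1 / c\<^sub>Y K) (1 / c' K \<rho>))" for K \<rho>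
  have R1: "0 < R + 1" and crude: "0 < crude \<rho>" "R \<le> crude \<rho>" for \<rho>
    using \<open>0 < R\<close> by (auto simp: crude_def)
  have pos: "0 < c\<^sub>X" "0 < c\<^sub>Y K" "0 < c' K \<rho>" for K \<rho>
    using rates_nonneg(1)[OF R1] rates_nonneg(2)[OF R1, of K]
      rates_nonneg(2)[OF crude(1)[of \<rho>], of K]
    by (auto simp: c\<^sub>X_def c\<^sub>Y_def c'_def)
  have C\<^sub>Y_pos: "0 < C\<^sub>Y K" for K
    by (simp add: C\<^sub>Y_def)
  have \<delta>: "0 < \<delta> K" "(\<delta> K)\<^sup>2 \<le> 1 / 8" "C\<^sub>Y K * (\<delta> K)\<^sup>2 \<le> 1 / 8" for K
  proof -
    have sq: "(\<delta> K)\<^sup>2 = min (1 / 8) (1 / (8 * C\<^sub>Y K))"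
      using C\<^sub>Y_pos[of K] by (simp add: \<delta>_def)
    then show "(\<delta> K)\<^sup>2 \<le> 1 / 8"
      by simp
    have "C\<^sub>Y K * (\<delta> K)\<^sup>2 \<le> C\<^sub>Y K * (1 / (8 * C\<^sub>Y K))"
      unfolding sq using C\<^sub>Y_pos[of K] by (intro mult_left_mono) auto
    then show "C\<^sub>Y K * (\<delta> K)\<^sup>2 \<le> 1 / 8"
      using C\<^sub>Y_pos[of K] by simp
    show "0 < \<delta> K"
      using C\<^sub>Y_pos[of K] by (simp add: \<delta>_def)
  qed
  have \<tau>\<^sub>0: "0 < \<tau>\<^sub>0 K \<rho>" for K \<rho>
    using pos(1) pos(2)[of K] pos(3)[of K \<rho>] by (simp add: \<tau>\<^sub>0_def)
  have small: "c\<^sub>X * \<tau> \<le> 1" "c\<^sub>Y K * \<tau> \<le> 1" "c' K \<rho> * \<tau> \<le> 1" if "\<tau> \<le> \<tau>\<^sub>0 K \<rho>" for \<tau> K \<rho>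
    using that pos(1) pos(2)[of K] pos(3)[of K \<rho>] by (auto simp: \<tau>\<^sub>0_def field_simps)
  have bounds: "(norm (u n - us n))\<^sup>2
        \<le> C\<^sub>Y K * ((norm (u 0 - us 0))\<^sup>2 + \<tau> * (\<Sum>k<n. (norm (d k))\<^sup>2)) \<and>
      (norm (emb (u n) - emb (us n)))\<^sup>2
        \<le> C\<^sub>X * ((norm (emb (u 0) - emb (us 0)))\<^sup>2 + \<tau> * (\<Sum>k<n. (norm (emb (d k)))\<^sup>2))"
    if "0 < \<tau>" and \<tau>: "\<tau> \<le> \<tau>\<^sub>0 K \<rho>"
      and u: "\<And>n. real n * \<tau> \<le> T \<Longrightarrow> midpoint_step emb A f \<tau> 0 (u n) (u (Suc n))"
      and incr: "\<And>n. real (Suc n) * \<tau> \<le> T \<Longrightarrow> norm (u (Suc n) - u n) \<le> \<rho>"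
      and us: "\<And>n. real n * \<tau> \<le> T \<Longrightarrow> midpoint_step emb A f \<tau> (d n) (us n) (us (Suc n))"
      and us_R: "\<And>n. real n * \<tau> \<le> T \<Longrightarrow> norm (us n) \<le> R"
      and us_K: "\<And>n. real n * \<tau> \<le> T \<Longrightarrow> \<exists>z. emb z = S (us n) \<and> norm z \<le> K"
      and pert: "(norm (u 0 - us 0))\<^sup>2 + \<tau> * (\<Sum>n | real n * \<tau> \<le> T. (norm (d n))\<^sup>2) \<le> (\<delta> K)\<^sup>2"
      and n: "real n * \<tau> \<le> T"
    for K \<rho> \<tau> u us d n
  proof -
    have mono: "real k * \<tau> \<le> T" if "k \<le> n" "real n * \<tau> \<le> T" for k n
      using that \<open>0 < \<tau>\<close> mult_right_mono[of "real k" "real n" \<tau>] by linarith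
    have "n \<le> nat \<lfloor>T / \<tau>\<rfloor>" if "real n * \<tau> \<le> T" for n
      using that \<open>0 < \<tau>\<close> by (simp add: le_nat_floor field_simps)
    then have "{n. real n * \<tau> \<le> T} \<subseteq> {..nat \<lfloor>T / \<tau>\<rfloor>}"
      by auto
    then have fin: "finite {n. real n * \<tau> \<le> T}"
      by (rule finite_subset) simp
    have partial: "(norm (u 0 - us 0))\<^sup>2 + \<tau> * (\<Sum>k\<in>I. (norm (d k))\<^sup>2) \<le> (\<delta> K)\<^sup>2"
      if "I \<subseteq> {n. real n * \<tau> \<le> T}" for I
    proof -
      have "\<tau> * (\<Sum>k\<in>I. (norm (d k))\<^sup>2) \<le> \<tau> * (\<Sum>n | real n * \<tau> \<le> T. (norm (d n))\<^sup>2)"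
        using \<open>0 < \<tau>\<close> by (intro mult_left_mono sum_mono2[OF fin that]) auto
      then show ?thesis
        using pert by simp
    qed
    have step_Y: "(norm (u (Suc k) - us (Suc k)))\<^sup>2
        \<le> (1 + 2 * (2 * rate_Y r K + 1) * \<tau>) * (norm (u k - us k))\<^sup>2 + 2 * \<tau> * (norm (d k))\<^sup>2"
      if k: "real (Suc k) * \<tau> \<le> T" and "R \<le> r" "norm (midpoint (u k) (u (Suc k))) \<le> r"
        "(2 * rate_Y r K + 1) * \<tau> \<le> 1" for k r
    proof -
      have k': "real k * \<tau> \<le> T"
        by (rule mono[OF _ k]) simp
      obtain z z' where "emb z = S (us k)" "norm z \<le> K" "emb z' = S (us (Suc k))" "norm z' \<le> K"
        using us_K[OF k] us_K[OF k'] by blast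
      then show ?thesis
        using midpoint_step_error(2)[OF u[OF k'] us[OF k'] \<open>0 < \<tau>\<close>] that us_R[OF k] us_R[OF k'] \<open>0 < R\<close>
        by fastforce
    qed
    have bound_Y: "(norm (u n - us n))\<^sup>2
        \<le> C\<^sub>Y K * ((norm (u 0 - us 0))\<^sup>2 + \<tau> * (\<Sum>k<n. (norm (d k))\<^sup>2))"
      if "real n * \<tau> \<le> T" "\<forall>k<n. norm (midpoint (u k) (u (Suc k))) \<le> R + 1" for n
      unfolding C\<^sub>Y_def
    proof (rule discrete_gronwall_exp[OF \<open>0 < \<tau>\<close> _ that(1)])
      show "(norm (u (Suc k) - us (Suc k)))\<^sup>2
          \<le> (1 + 2 * c\<^sub>Y K * \<tau>) * (norm (u k - us k))\<^sup>2 + 2 * \<tau> * (norm (d k))\<^sup>2" if "k < n" for k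
        using step_Y[of k "R + 1"] mono[of "Suc k" n] that \<open>real n * \<tau> \<le> T\<close>
          \<open>\<forall>k<n. norm (midpoint (u k) (u (Suc k))) \<le> R + 1\<close> small(2)[OF \<tau>]
        by (simp add: c\<^sub>Y_def)
    qed (use pos(2)[of K] in auto)
    have midpoints: "\<forall>k<n. norm (midpoint (u k) (u (Suc k))) \<le> R + 1" if "real n * \<tau> \<le> T" for n
      using that
    proof (induction n)
      case 0
      then show ?case by simp
    next
      case (Suc n)
      have n: "real n * \<tau> \<le> T"
        by (rule mono[OF _ Suc.prems]) simp
      note IH = Suc.IH[OF n]
      have "C\<^sub>Y K * ((norm (u 0 - us 0))\<^sup>2 + \<tau> * (\<Sum>k<n. (norm (d k))\<^sup>2)) \<le> C\<^sub>Y K * (\<delta> K)\<^sup>2"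
        using C\<^sub>Y_pos[of K] mono[OF _ n] by (intro mult_left_mono partial) auto
      then have error: "(norm (u n - us n))\<^sup>2 \<le> 1 / 8"
        using bound_Y[OF n IH] \<delta>(3)[of K] by linarith
      then have "norm (u n - us n) \<le> 1"
        using power_le_one_iff[of "norm (u n - us n)" 2] by simp
      then have u_n: "norm (u n) \<le> R + 1"
        using norm_triangle_sub[of "u n" "us n"] us_R[OF n] by linarith
      have "midpoint (u n) (u (Suc n)) = u n + (1 / 2) *\<^sub>R (u (Suc n) - u n)"
        by (simp add: midpoint_def algebra_simps flip: scaleR_add_left)
      then have "norm (midpoint (u n) (u (Suc n))) \<le> norm (u n) + norm (u (Suc n) - u n) / 2"
        using norm_triangle_ineq[of "u n" "(1 / 2) *\<^sub>R (u (Suc n) - u n)"] by simp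
      then have "norm (midpoint (u n) (u (Suc n))) \<le> crude \<rho>"
        using u_n incr[OF Suc.prems] norm_ge_zero[of "u (Suc n) - u n"] by (simp add: crude_def)
      then have "(norm (u (Suc n) - us (Suc n)))\<^sup>2
          \<le> (1 + 2 * c' K \<rho> * \<tau>) * (norm (u n - us n))\<^sup>2 + 2 * \<tau> * (norm (d n))\<^sup>2"
        using step_Y[OF Suc.prems crude(2)] small(3)[OF \<tau>] by (simp add: c'_def)
      also have "\<dots> \<le> 3 * (1 / 8) + 2 * (1 / 8)"
      proof (rule add_mono)
        show "(1 + 2 * c' K \<rho> * \<tau>) * (norm (u n - us n))\<^sup>2 \<le> 3 * (1 / 8)"
          using small(3)[OF \<tau>] error by (intro mult_mono) auto
        have "(norm (u 0 - us 0))\<^sup>2 + \<tau> * (norm (d n))\<^sup>2 \<le> (\<delta> K)\<^sup>2"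
          using partial[of "{n}"] n by simp
        then have "\<tau> * (norm (d n))\<^sup>2 \<le> 1 / 8"
          using \<delta>(2)[of K] zero_le_power2[of "norm (u 0 - us 0)"] by linarith
        then show "2 * \<tau> * (norm (d n))\<^sup>2 \<le> 2 * (1 / 8)"
          by simp
      qed
      finally have "(norm (u (Suc n) - us (Suc n)))\<^sup>2 \<le> 1"
        by simp
      then have "norm (u (Suc n) - us (Suc n)) \<le> 1"
        using power_le_one_iff[of "norm (u (Suc n) - us (Suc n))" 2] by simp
      then have "norm (u (Suc n)) \<le> R + 1"
        using norm_triangle_sub[of "u (Suc n)" "us (Suc n)"] us_R[OF Suc.prems] by linarith
      then show ?case
        using IH norm_midpoint_le[OF u_n] by (auto simp: less_Suc_eq)
    qed
    have "(norm (emb (u n) - emb (us n)))\<^sup>2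
        \<le> C\<^sub>X * ((norm (emb (u 0) - emb (us 0)))\<^sup>2 + \<tau> * (\<Sum>k<n. (norm (emb (d k)))\<^sup>2))"
      unfolding C\<^sub>X_def
    proof (rule discrete_gronwall_exp[OF \<open>0 < \<tau>\<close> _ n])
      fix k assume "k < n"
      then have k: "real k * \<tau> \<le> T" "real (Suc k) * \<tau> \<le> T"
        using mono[of k n] mono[of "Suc k" n] n by auto
      show "(norm (emb (u (Suc k)) - emb (us (Suc k))))\<^sup>2
          \<le> (1 + 2 * c\<^sub>X * \<tau>) * (norm (emb (u k) - emb (us k)))\<^sup>2 + 2 * \<tau> * (norm (emb (d k)))\<^sup>2"
        using midpoint_step_error(1)[OF u[OF k(1)] us[OF k(1)] \<open>0 < \<tau>\<close> R1] us_R[OF k(1)] us_R[OF k(2)]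
          midpoints[OF n] \<open>k < n\<close> small(1)[OF \<tau>]
        by (simp add: c\<^sub>X_def)
    qed (use pos(1) in auto)
    then show ?thesis
      using bound_Y[OF n midpoints[OF n]] by blast
  qed
  show ?thesis
  proof (rule exI[of _ C\<^sub>X], rule allI)
    fix K :: real
    show "\<exists>C\<^sub>Y::real. \<exists>\<delta>>0. \<forall>\<rho>::real. \<exists>\<tau>\<^sub>0>0.
      \<forall>(\<tau>::real) (u :: nat \<Rightarrow> 'y) (us :: nat \<Rightarrow> 'y) (d :: nat \<Rightarrow> 'y).
      0 < \<tau> \<longrightarrow> \<tau> \<le> \<tau>\<^sub>0 \<longrightarrow>
      (\<forall>n. real n * \<tau> \<le> T \<longrightarrow> midpoint_step emb A f \<tau> 0 (u n) (u (Suc n))) \<longrightarrow>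
      (\<forall>n. real (Suc n) * \<tau> \<le> T \<longrightarrow> norm (u (Suc n) - u n) \<le> \<rho>) \<longrightarrow>
      (\<forall>n. real n * \<tau> \<le> T \<longrightarrow> midpoint_step emb A f \<tau> (d n) (us n) (us (Suc n))) \<longrightarrow>
      (\<forall>n. real n * \<tau> \<le> T \<longrightarrow> norm (us n) \<le> R) \<longrightarrow>
      (\<forall>n. real n * \<tau> \<le> T \<longrightarrow> (\<exists>z. emb z = S (us n) \<and> norm z \<le> K)) \<longrightarrow>
      (norm (u 0 - us 0))\<^sup>2 + \<tau> * (\<Sum>n | real n * \<tau> \<le> T. (norm (d n))\<^sup>2) \<le> \<delta>\<^sup>2 \<longrightarrow>
      (\<forall>n. real n * \<tau> \<le> T \<longrightarrow>
         (norm (u n - us n))\<^sup>2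
           \<le> C\<^sub>Y * ((norm (u 0 - us 0))\<^sup>2 + \<tau> * (\<Sum>k<n. (norm (d k))\<^sup>2)) \<and>
         (norm (emb (u n) - emb (us n)))\<^sup>2
           \<le> C\<^sub>X * ((norm (emb (u 0) - emb (us 0)))\<^sup>2 + \<tau> * (\<Sum>k<n. (norm (emb (d k)))\<^sup>2)))"
      apply (rule exI[of _ "C\<^sub>Y K"], rule exI[of _ "\<delta> K"], rule conjI[OF \<delta>(1)], rule allI)
      subgoal for \<rho>
        apply (rule exI[of _ "\<tau>\<^sub>0 K \<rho>"], rule conjI[OF \<tau>\<^sub>0], intro allI impI)
        subgoal for \<tau> u us d n
          by (rule bounds[where K = K and \<rho> = \<rho>]; blast)
        done
      done
  qed
qed

end
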